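(* Let $C \ge 1$ be a real number, let $1\le k\le N$ be integers, and let $p$ be such that $$\sqrt{12+16C^2}\cdot e^{-\frac{\ln(6+8C^2)}{2}\cdot N} \le p < 1 .$$ Then any $\ell_2/\ell_2$ foreach sparse recovery scheme (with sparsity $k$) using $m\times N$ measurement matrices $\Phi$, with failure probability at most $p$ and approximation factor $C$, must have $$ m \ \ge\ \frac{1}{(6+8C^2)\ln(6+8C^2)}\,\ln\!\left(\frac{\sqrt{12+16C^2}}{p}\right) \;=\; \Omega(\log(1/p))$$ measurements.
   Context: For $\mathbf{x}\in\mathbb{R}^N$, $\mathbf{x}_k$ denotes a best $k$-sparse approximation of $\mathbf{x}$ (keep the $k$ largest-magnitude coordinates, set the others to zero). An $\ell_2/\ell_2$ foreach sparse recovery scheme with $m$ measurements, sparsity $k$, approximation factor $C$ and failure probability at most $p$ is a probability distribution over pairs $(\Phi,A)$, where $\Phi\in\mathbb{R}^{m\times N}$ is a measurement matrix and $A:\mathbb{R}^m\to\mathbb{R}^N$ is a (deterministic) decoding map, such that for every fixed $\mathbf{x}\in\mathbb{R}^N$, $$\Pr_{(\Phi,A)}\big[\|\mathbf{x}-A(\Phi\mathbf{x})\|_2\le C\,\|\mathbf{x}-\mathbf{x}_k\|_2\big]\ \ge\ 1-p .$$ The constant hidden in the final $\Omega(\cdot)$ may depend on $C$.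
   Formalization: The event that (Φ,A) recovers x is assumed jointly measurable in ((Φ,A),x), with x ranging over the Borel space ℝ^N; if it is only measurable for each fixed x, a pathological distribution with m = 1 and failure probability 0 violates the bound. *)

theory Defs
  imports "HOL-Probability.Probability" "HOL-Library.Landau_Symbols"
begin

definition largest_coords :: "nat \<Rightarrow> real ^ 'n \<Rightarrow> 'n set \<Rightarrow> bool" where
  "largest_coords k x S \<longleftrightarrow> card S = k \<and> (\<forall>i\<in>S. \<forall>j\<in>-S. \<bar>x $ j\<bar> \<le> \<bar>x $ i\<bar>)"

lemma largest_coords_exists:
  fixes x :: "real ^ 'n"
  assumes "k \<le> CARD('n)"
  shows "\<exists>S. largest_coords k x S"
  using assms
proof (induction k)
  case 0
  then show ?case by (auto simp: largest_coords_def intro: exI[of _ "{}"])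
next
  case (Suc k)
  then obtain S where S: "largest_coords k x S" by auto
  have "- S \<noteq> {}"
  proof
    assume "- S = {}"
    then have "S = UNIV" by auto
    then show False using S Suc.prems by (simp add: largest_coords_def)
  qed
  then have "Max ((\<lambda>i. \<bar>x $ i\<bar>) ` (- S)) \<in> (\<lambda>i. \<bar>x $ i\<bar>) ` (- S)"
    by (intro Max_in) auto
  then obtain a where a: "a \<in> - S" "Max ((\<lambda>i. \<bar>x $ i\<bar>) ` (- S)) = \<bar>x $ a\<bar>"
    by blast
  have "\<forall>j\<in>- S. \<bar>x $ j\<bar> \<le> \<bar>x $ a\<bar>"
    unfolding a(2)[symmetric] by simp
  have "largest_coords (Suc k) x (insert a S)"
    using S a(1) \<open>\<forall>j\<in>- S. \<bar>x $ j\<bar> \<le> \<bar>x $ a\<bar>\<close>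
    by (auto simp: largest_coords_def)
  then show ?case by blast
qed

text \<open>Ties are broken arbitrarily; the norm of \<open>x - sparse_approx k x\<close> does not depend on the
  choice. Only meaningful for \<open>k \<le> CARD('n)\<close>.\<close>

definition sparse_approx :: "nat \<Rightarrow> real ^ 'n \<Rightarrow> real ^ 'n" where
  "sparse_approx k x =
     (let S = (SOME S. largest_coords k x S) in \<chi> i. if i \<in> S then x $ i else 0)"

text \<open>The number \<open>m\<close> of measurements is a natural number rather than the cardinality of an index
  type, so that \<open>m = 0\<close> is allowed. An \<open>m \<times> N\<close> matrix is given by its rows \<open>\<Phi> i\<close> with
  \<open>i < m\<close> (the other values of \<open>\<Phi>\<close> are ignored), and a vector of measurements is a function
  that is extensional on \<open>{..<m}\<close>.\<close>

definition measurements :: "nat \<Rightarrow> (nat \<Rightarrow> real ^ 'n) \<Rightarrow> real ^ 'n \<Rightarrow> (nat \<Rightarrow> real)" where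
  "measurements m \<Phi> x = (\<lambda>i\<in>{..<m}. \<Sum>j\<in>UNIV. \<Phi> i $ j * x $ j)"

definition recovers ::
  "nat \<Rightarrow> nat \<Rightarrow> real \<Rightarrow> (nat \<Rightarrow> real ^ 'n) \<Rightarrow> ((nat \<Rightarrow> real) \<Rightarrow> real ^ 'n) \<Rightarrow> real ^ 'n \<Rightarrow> bool" where
  "recovers m k C \<Phi> A x \<longleftrightarrow>
     norm (x - A (measurements m \<Phi> x)) \<le> C * norm (x - sparse_approx k x)"

text \<open>The distribution \<open>M\<close> of \<open>(\<Phi>, A)\<close> may live on any \<open>\<sigma>\<close>-algebra on the pairs, and no
  decoder has to be measurable by itself. What is required is that the success event is jointly
  measurable in \<open>((\<Phi>, A), x)\<close>. This implies that the success event for each fixed \<open>x\<close> has a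
  probability. Measurability for each fixed \<open>x\<close> alone would not be enough: along a well-ordering of
  \<open>\<real>\<^sup>N\<close> of minimal length, a single generic linear measurement, with a suitable decoder,
  recovers all vectors preceding a given one, and the two-valued measure on bounded and co-bounded
  sets of indices then gives a one-measurement scheme with failure probability \<open>0\<close>.\<close>

definition foreach_scheme ::
  "nat \<Rightarrow> nat \<Rightarrow> real \<Rightarrow> real \<Rightarrow>
   ((nat \<Rightarrow> real ^ 'n) \<times> ((nat \<Rightarrow> real) \<Rightarrow> real ^ 'n)) measure \<Rightarrow> bool" where
  "foreach_scheme m k C p M \<longleftrightarrow>
     prob_space M \<and>
     Measurable.pred (M \<Otimes>\<^sub>M borel) (\<lambda>((\<Phi>, A), x). recovers m k C \<Phi> A x) \<and>
     (\<forall>x. measure M {(\<Phi>, A) \<in> space M. recovers m k C \<Phi> A x} \<ge> 1 - p)"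

end

theory Submission
  imports Defs
begin

text \<open>
  By Fubini, it suffices to exhibit one distribution of \<open>x\<close> on which every deterministic scheme with
  few measurements fails with probability more than \<open>p\<close>. Put \<open>D = 6 + 8 C\<^sup>2\<close> and let \<open>T\<close> be a set of
  about \<open>2 ln (sqrt (2 D) / p) / ln D\<close> coordinates. If \<open>m\<close> is small compared with \<open>card T\<close>, a trace
  argument gives \<open>j \<in> T\<close> such that the projection \<open>u\<close> of \<open>e\<^sub>j\<close> to the span of the rows restricted to
  \<open>T\<close> is short. Then \<open>e\<^sub>j\<close> and its reflection \<open>2 u - e\<^sub>j\<close> have equal measurements, are far apart, and
  are both nearly 1-sparse; for every small perturbation \<open>z\<close> the decoder must therefore fail on
  \<open>e\<^sub>j + z\<close> or on \<open>2 u - e\<^sub>j + z\<close>. Taking \<open>x\<close> uniform in a product of a ball in \<open>\<real>\<^sup>T\<close> of radius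
  \<open>1 + 1 / (2 C)\<close> and a small ball in the other coordinates, these perturbations occupy the fraction
  \<open>1 / (2 C + 1) ^ card T\<close> of the volume, which exceeds \<open>2 p\<close> because \<open>D \<ge> 3 / 2 * (2 C + 1)\<^sup>2\<close>.
\<close>

section \<open>Sparse approximation error and vectors with equal measurements\<close>

lemma norm_vec_power2: "(norm (x :: real ^ 'n))\<^sup>2 = (\<Sum>i\<in>UNIV. (x $ i)\<^sup>2)"
  unfolding power2_norm_eq_inner inner_vec_def by (simp add: power2_eq_square)

text \<open>As \<open>k\<close> is at least 1, the kept set contains an index whose entry is at
  least as large as entry \<open>j\<close>. Dropping that entry alone already does no worse than
  dropping entry \<open>j\<close>.\<close>

lemma sparse_approx_error_le:
  fixes x :: "real ^ 'n"
  assumes k: "1 \<le> k" "k \<le> CARD('n)"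
  shows "norm (x - sparse_approx k x) \<le> norm (x - t *\<^sub>R axis j 1)"
proof -
  define S where "S = (SOME S. largest_coords k x S)"
  have S: "largest_coords k x S"
    unfolding S_def using largest_coords_exists[OF k(2)] by (rule someI_ex)
  have "S \<noteq> {}" using S k(1) by (auto simp: largest_coords_def)
  then obtain i where i: "i \<in> S" "j \<in> S \<longrightarrow> i = j" by blast
  have ij: "\<bar>x $ j\<bar> \<le> \<bar>x $ i\<bar>"
    using S i by (cases "j \<in> S") (auto simp: largest_coords_def)
  have "(norm (x - sparse_approx k x))\<^sup>2 = (\<Sum>l\<in>UNIV. if l \<in> S then 0 else (x $ l)\<^sup>2)"
    unfolding norm_vec_power2 sparse_approx_def S_def[symmetric] by (intro sum.cong) auto
  also have "\<dots> \<le> (\<Sum>l\<in>UNIV. if l = i then 0 else (x $ l)\<^sup>2)"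
    using i by (intro sum_mono) auto
  also have "\<dots> = (\<Sum>l\<in>UNIV. (x $ l)\<^sup>2) - (x $ i)\<^sup>2"
    by (simp add: sum.remove[of UNIV i])
  also have "\<dots> \<le> (\<Sum>l\<in>UNIV. (x $ l)\<^sup>2) - (x $ j)\<^sup>2"
    using ij by (simp add: abs_le_square_iff)
  also have "\<dots> = (\<Sum>l\<in>UNIV. if l = j then 0 else (x $ l)\<^sup>2)"
    by (simp add: sum.remove[of UNIV j])
  also have "\<dots> \<le> (norm (x - t *\<^sub>R axis j 1))\<^sup>2"
    unfolding norm_vec_power2 by (intro sum_mono) (auto simp: axis_def)
  finally show ?thesis by (rule power2_le_imp_le) simp
qed

lemma measurements_eqI:
  assumes "\<And>i. i < m \<Longrightarrow> \<Phi> i \<bullet> (x - y) = 0"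
  shows "measurements m \<Phi> x = measurements m \<Phi> y"
proof -
  have "(\<Sum>j\<in>UNIV. \<Phi> i $ j * x $ j) = (\<Sum>j\<in>UNIV. \<Phi> i $ j * y $ j)" if "i < m" for i
    using assms[OF that] by (simp add: inner_diff_right) (simp add: inner_vec_def)
  then show ?thesis by (auto simp: measurements_def restrict_def fun_eq_iff)
qed

text \<open>The decoder cannot tell \<open>x\<close> from \<open>y\<close>, so a single output
  \<open>z\<close> must be close to both; the triangle inequality through \<open>z\<close>
  concludes.\<close>

lemma recovers_imp_dist_le:
  fixes x y :: "real ^ 'n"
  assumes k: "1 \<le> k" "k \<le> CARD('n)" and "0 \<le> C"
    and eq: "measurements m \<Phi> x = measurements m \<Phi> y"
    and rec: "recovers m k C \<Phi> A x" "recovers m k C \<Phi> A y"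
  shows "norm (x - y) \<le> C * (norm (x - s *\<^sub>R axis i 1) + norm (y - t *\<^sub>R axis j 1))"
proof -
  define z where "z = A (measurements m \<Phi> x)"
  have "norm (x - y) \<le> norm (x - z) + norm (y - z)"
    using norm_triangle_ineq4[of "x - z" "y - z"] by simp
  also have "\<dots> \<le> C * norm (x - sparse_approx k x) + C * norm (y - sparse_approx k y)"
    using rec unfolding recovers_def eq[symmetric] z_def by (intro add_mono)
  also have "\<dots> \<le> C * norm (x - s *\<^sub>R axis i 1) + C * norm (y - t *\<^sub>R axis j 1)"
    using \<open>0 \<le> C\<close> by (intro add_mono mult_left_mono sparse_approx_error_le k)
  finally show ?thesis by (simp add: distrib_left)
qed

section \<open>Restriction to coordinates and the trace argument\<close>

definition vec_restrict :: "'n set \<Rightarrow> real ^ 'n \<Rightarrow> real ^ 'n" where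
  "vec_restrict T x = (\<chi> i. if i \<in> T then x $ i else 0)"

lemma vec_restrict_nth [simp]: "vec_restrict T x $ i = (if i \<in> T then x $ i else 0)"
  by (simp add: vec_restrict_def)

lemma bounded_linear_vec_restrict: "bounded_linear (vec_restrict T)"
  by (intro linear_conv_bounded_linear[THEN iffD1] linearI) (simp_all add: vec_eq_iff)

text \<open>The squared lengths of the projections of the unit vectors are the diagonal entries of a
  projection matrix of rank at most \<open>m\<close>, so some \<open>j\<close> in \<open>T\<close>
  has at most the average. The last conclusion says that no row of \<open>\<Phi>\<close> sees the
  unit vector minus \<open>u\<close>.\<close>

lemma exists_coordinate_small_projection:
  fixes \<Phi> :: "nat \<Rightarrow> real ^ 'n" and T :: "'n set"
  assumes "T \<noteq> {}"
  obtains j u where "j \<in> T" "vec_restrict T u = u" "u $ j = (norm u)\<^sup>2"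
    "(norm u)\<^sup>2 \<le> real m / real (card T)" "\<And>i. i < m \<Longrightarrow> \<Phi> i \<bullet> u = \<Phi> i $ j"
proof -
  define W where "W = span ((\<lambda>i. vec_restrict T (\<Phi> i)) ` {..<m})"
  obtain B where B: "B \<subseteq> W" "pairwise orthogonal B" "\<And>x. x \<in> B \<Longrightarrow> norm x = 1"
    "independent B" "card B = dim W" "span B = W"
    using orthonormal_basis_subspace[of W] by (auto simp: W_def)
  have fin: "finite B" using B(4) by (rule independent_imp_finite)
  have dimW: "dim W \<le> m"
    unfolding W_def dim_span
    by (rule order_trans[OF dim_le_card'[of "(\<lambda>i. vec_restrict T (\<Phi> i)) ` {..<m}"]])
       (use card_image_le[of "{..<m}" "\<lambda>i. vec_restrict T (\<Phi> i)"] in auto)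
  \<comment> \<open>\<open>u j\<close> is the orthogonal projection of \<open>axis j 1\<close> to
    \<open>W\<close>, written in the orthonormal basis \<open>B\<close>.\<close>
  define u where "u j = (\<Sum>b\<in>B. (b $ j) *\<^sub>R b)" for j
  have bb: "b \<bullet> b = 1" if "b \<in> B" for b
    using B(3)[OF that] by (simp add: power2_norm_eq_inner[symmetric])
  have orth: "w \<bullet> u j = w $ j" if "w \<in> W" for w j
  proof -
    have "orthogonal w (axis j 1 - (\<Sum>b\<in>B. (b \<bullet> axis j 1 / (b \<bullet> b)) *\<^sub>R b))"
      using B that by (intro Gram_Schmidt_step) auto
    also have "(\<Sum>b\<in>B. (b \<bullet> axis j 1 / (b \<bullet> b)) *\<^sub>R b) = u j"
      unfolding u_def by (intro sum.cong) (auto simp: bb inner_axis)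
    finally show ?thesis by (simp add: orthogonal_def inner_diff_right inner_axis)
  qed
  have uW: "u j \<in> W" for j
    unfolding u_def B(6)[symmetric] by (intro span_sum span_scale span_base)
  have supp: "vec_restrict T w = w" if "w \<in> W" for w
  proof -
    have "W \<subseteq> {w. vec_restrict T w = w}"
      unfolding W_def
      by (intro span_minimal) (auto simp: subspace_def vec_eq_iff)
    then show ?thesis using that by auto
  qed
  have nu: "(norm (u j))\<^sup>2 = u j $ j" for j
    using orth[OF uW] by (simp add: power2_norm_eq_inner)
  \<comment> \<open>This is the trace bound: each unit vector of \<open>B\<close> contributes at
    most 1.\<close>
  have "(\<Sum>j\<in>T. u j $ j) = (\<Sum>b\<in>B. \<Sum>j\<in>T. (b $ j)\<^sup>2)"
    unfolding u_def by (subst sum.swap) (simp add: power2_eq_square)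
  also have "\<dots> \<le> (\<Sum>b\<in>B. (norm b)\<^sup>2)"
    unfolding norm_vec_power2 by (intro sum_mono sum_mono2) auto
  also have "\<dots> = real (card B)" using B(3) by simp
  also have "\<dots> \<le> real m" using dimW B(5) by simp
  finally have le: "(\<Sum>j\<in>T. u j $ j) \<le> real m" .
  have "\<exists>j\<in>T. u j $ j \<le> real m / real (card T)"
  proof (rule ccontr)
    assume "\<not> ?thesis"
    then have "(\<Sum>j\<in>T. real m / real (card T)) < (\<Sum>j\<in>T. u j $ j)"
      using assms by (intro sum_strict_mono) auto
    with le assms show False by simp
  qed
  then obtain j where j: "j \<in> T" "u j $ j \<le> real m / real (card T)" ..
  show ?thesis
  proof (rule that[of j "u j"])
    fix i assume "i < m"
    then have i: "vec_restrict T (\<Phi> i) \<in> W" by (auto simp: W_def intro: span_base)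
    have "\<Phi> i \<bullet> u j = \<Phi> i \<bullet> vec_restrict T (u j)" using supp[OF uW] by simp
    also have "\<dots> = vec_restrict T (\<Phi> i) \<bullet> u j"
      unfolding inner_vec_def by (intro sum.cong) auto
    also have "\<dots> = \<Phi> i $ j" using orth[OF i] j by simp
    finally show "\<Phi> i \<bullet> u j = \<Phi> i $ j" .
  qed (use j supp[OF uW] nu in auto)
qed

section \<open>Products of balls and their volumes\<close>

text \<open>The product of a ball in the coordinates of \<open>T\<close> and a ball in the others,
  kept inside \<open>real ^ 'n\<close> so that \<open>lborel\<close> applies directly.\<close>

definition cylinder :: "'n set \<Rightarrow> real \<Rightarrow> real \<Rightarrow> (real ^ 'n) set" where
  "cylinder T a b = {x. norm (vec_restrict T x) \<le> a \<and> norm (x - vec_restrict T x) \<le> b}"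

lemma norm_le_of_mem_cylinder: "x \<in> cylinder T a b \<Longrightarrow> norm x \<le> a + b"
  using norm_triangle_ineq[of "vec_restrict T x" "x - vec_restrict T x"]
  by (simp add: cylinder_def)

lemma cylinder_borel [measurable]: "cylinder T a b \<in> sets borel"
proof -
  interpret bounded_linear "vec_restrict T" by (rule bounded_linear_vec_restrict)
  show ?thesis unfolding cylinder_def
    by (intro borel_closed closed_Collect_conj closed_Collect_le continuous_intros
        continuous_on continuous_on_id)
qed

lemma emeasure_cylinder_finite: "emeasure lborel (cylinder T a b) < \<infinity>"
  by (intro emeasure_bounded_finite boundedI[of _ "a + b"] norm_le_of_mem_cylinder)

lemma norm_vec_restrict_le: "norm (vec_restrict T x) \<le> norm x"
  by (rule norm_le_componentwise_cart) simp

lemma emeasure_cylinder_pos: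
  fixes T :: "'n::finite set"
  assumes "0 < a" "0 < b"
  shows "0 < emeasure lborel (cylinder T a b)"
proof -
  have "norm (x - vec_restrict T x) \<le> norm x" for x :: "real ^ 'n"
    by (rule norm_le_componentwise_cart) simp
  then have "norm (x - vec_restrict T x) \<le> b" if "norm x < b" for x :: "real ^ 'n"
    using that by (meson less_imp_le order_trans)
  moreover have "norm (vec_restrict T x) \<le> a" if "norm x < a" for x :: "real ^ 'n"
    using that norm_vec_restrict_le[of T x] by simp
  ultimately have "ball 0 (min a b) \<subseteq> cylinder T a b"
    by (auto simp: cylinder_def)
  then have "emeasure lborel (ball 0 (min a b) :: (real ^ 'n) set) \<le> emeasure lborel (cylinder T a b)"
    by (intro emeasure_mono) auto
  moreover have "0 < emeasure lborel (ball 0 (min a b) :: (real ^ 'n) set)"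
    using assms by (simp add: emeasure_ball)
  ultimately show ?thesis by (rule less_le_trans[rotated])
qed

text \<open>Stretching only the coordinates in \<open>T\<close> by \<open>r\<close> has determinant
  \<open>r ^ card T\<close> and maps one cylinder onto the other.\<close>

lemma emeasure_cylinder_scale:
  fixes T :: "'n::finite set"
  assumes "0 < r"
  shows "emeasure lborel (cylinder T (r * a) b) = ennreal (r ^ card T) * emeasure lborel (cylinder T a b)"
proof -
  define c where "c v = (if \<exists>i\<in>T. v = axis i 1 then r else 1)" for v :: "real ^ 'n"
  \<comment> \<open>The summand 0 gives \<open>F\<close> the shape expected by
    \<open>lborel_affine_euclidean\<close>.\<close>
  define F where "F x = (0 :: real ^ 'n) + (\<Sum>j\<in>Basis. (c j * (x \<bullet> j)) *\<^sub>R j)" for x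
  have c_axis: "c (axis i 1) = (if i \<in> T then r else 1)" for i
    by (auto simp: c_def axis_eq_axis)
  have Fm [measurable]: "F \<in> borel_measurable borel"
    unfolding F_def by measurable
  have F_nth: "F x $ i = (if i \<in> T then r * x $ i else x $ i)" for x i
  proof -
    have "F x $ i = F x \<bullet> axis i 1" by (simp add: inner_axis)
    also have "\<dots> = c (axis i 1) * (x \<bullet> axis i 1)"
      unfolding F_def by (simp add: inner_sum_left inner_Basis if_distrib cong: if_cong)
    finally show ?thesis by (simp add: c_axis inner_axis)
  qed
  have Fr: "vec_restrict T (F x) = r *\<^sub>R vec_restrict T x"
    "F x - vec_restrict T (F x) = x - vec_restrict T x" for x
    by (auto simp: vec_eq_iff F_nth)
  have pre: "F -` cylinder T (r * a) b = cylinder T a b"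
    unfolding cylinder_def vimage_def mem_Collect_eq Fr(2) using assms by (simp add: Fr(1))
  have "(\<Prod>j\<in>Basis. \<bar>c j\<bar>) = (\<Prod>j\<in>range (\<lambda>i. axis i 1 :: real ^ 'n). \<bar>c j\<bar>)"
    by (intro prod.cong) (auto simp: Basis_vec_def)
  also have "\<dots> = (\<Prod>i\<in>UNIV. if i \<in> T then r else 1)"
    using assms by (subst prod.reindex) (auto simp: inj_on_def axis_eq_axis c_axis intro!: prod.cong)
  also have "\<dots> = r ^ card T" by (simp add: prod.If_cases)
  finally have prod_c: "(\<Prod>j\<in>Basis. \<bar>c j\<bar>) = r ^ card T" .
  have "lborel = density (distr lborel borel F) (\<lambda>_. ennreal (\<Prod>j\<in>Basis. \<bar>c j\<bar>))"
    unfolding F_def by (rule lborel_affine_euclidean) (use assms in \<open>auto simp: c_def\<close>)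
  then have "emeasure lborel (cylinder T (r * a) b)
    = emeasure (density (distr lborel borel F) (\<lambda>_. ennreal (r ^ card T))) (cylinder T (r * a) b)"
    by (simp only: prod_c)
  also have "\<dots> = ennreal (r ^ card T) * emeasure (distr lborel borel F) (cylinder T (r * a) b)"
    by (subst emeasure_density_const) auto
  also have "emeasure (distr lborel borel F) (cylinder T (r * a) b) = emeasure lborel (cylinder T a b)"
    by (subst emeasure_distr) (auto simp: pre)
  finally show ?thesis .
qed

section \<open>Two indistinguishable families of nearly sparse vectors\<close>

text \<open>Double success would force \<open>norm (e - u)\<close> to be at most 9/10, whereas its
  square is \<open>1 - (norm u)\<^sup>2\<close>, hence at least 91/100.\<close>

lemma ambiguous_pair:
  fixes \<Phi> :: "nat \<Rightarrow> real ^ 'n" and T :: "'n set"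
  assumes C: "C \<ge> 1" and k: "1 \<le> k" "k \<le> CARD('n)" and T: "T \<noteq> {}"
    and m: "real m / real (card T) \<le> 9 / (100 * C\<^sup>2)"
  obtains a a' where "vec_restrict T a = a" "norm a = 1" "vec_restrict T a' = a'" "norm a' = 1"
    "\<And>A z. z \<in> cylinder T (1 / (2 * C)) (1 / (10 * C)) \<Longrightarrow>
        \<not> recovers m k C \<Phi> A (a + z) \<or> \<not> recovers m k C \<Phi> A (a' + z)"
proof -
  obtain j u where ju: "j \<in> T" "vec_restrict T u = u" "u $ j = (norm u)\<^sup>2"
    "(norm u)\<^sup>2 \<le> real m / real (card T)" "\<And>i. i < m \<Longrightarrow> \<Phi> i \<bullet> u = \<Phi> i $ j"
    using exists_coordinate_small_projection[OF T] by metis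
  define e where "e = (axis j 1 :: real ^ 'n)"
  define a' where "a' = 2 *\<^sub>R u - e"
  have eu: "e \<bullet> u = (norm u)\<^sup>2" "e \<bullet> e = 1" "norm e = 1"
    by (auto simp: e_def inner_axis' ju(3))
  have u2: "(norm u)\<^sup>2 \<le> (3 / (10 * C))\<^sup>2"
    using order_trans[OF ju(4) m] by (simp add: power2_eq_square)
  then have nu: "norm u \<le> 3 / (10 * C)"
    by (rule power2_le_imp_le) (use C in simp)
  have "C\<^sup>2 \<ge> 1" using C by simp
  then have "(3 / (10 * C))\<^sup>2 \<le> 9 / 100"
    by (simp add: divide_simps power_mult_distrib)
  with u2 have u9: "(norm u)\<^sup>2 \<le> 9 / 100" by simp
  \<comment> \<open>A reflection preserves length; here this uses that \<open>e \<bullet> u\<close>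
    is the squared norm of \<open>u\<close>.\<close>
  have "(norm a')\<^sup>2 = 1"
    unfolding a'_def power2_norm_eq_inner
    using eu(1,2) by (simp add: algebra_simps inner_commute power2_norm_eq_inner)
  then have na': "norm a' = 1" by (simp add: power2_eq_1_iff) (use norm_ge_zero[of a'] in linarith)
  have neu: "(norm (e - u))\<^sup>2 = 1 - (norm u)\<^sup>2"
    unfolding power2_norm_eq_inner
    using eu(1,2) by (simp add: algebra_simps inner_commute power2_norm_eq_inner)
  show thesis
  proof (rule that[of e a'])
    show "vec_restrict T e = e" using ju(1) by (auto simp: vec_eq_iff e_def axis_def)
    with ju(2) show "vec_restrict T a' = a'"
      by (simp add: a'_def bounded_linear.linear[OF bounded_linear_vec_restrict]
          linear_diff linear_scale)
    fix A z assume z: "z \<in> cylinder T (1 / (2 * C)) (1 / (10 * C))"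
    have nz: "norm z \<le> 6 / (10 * C)"
      using norm_le_of_mem_cylinder[OF z] C by (simp add: field_simps)
    show "\<not> recovers m k C \<Phi> A (e + z) \<or> \<not> recovers m k C \<Phi> A (a' + z)"
    proof (rule ccontr)
      assume "\<not> ?thesis"
      then have rec: "recovers m k C \<Phi> A (e + z)" "recovers m k C \<Phi> A (a' + z)" by auto
      have diff: "e + z - (a' + z) = 2 *\<^sub>R (e - u)"
        by (simp add: a'_def vec_eq_iff algebra_simps)
      have eq: "measurements m \<Phi> (e + z) = measurements m \<Phi> (a' + z)"
      proof (rule measurements_eqI)
        fix i assume "i < m"
        then show "\<Phi> i \<bullet> (e + z - (a' + z)) = 0"
          using ju(5)[of i] unfolding diff by (simp add: e_def inner_diff_right inner_axis)
      qed
      have "2 * norm (e - u) = norm (e + z - (a' + z))" unfolding diff by simp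
      \<comment> \<open>The vector \<open>a' + z\<close> is compared with \<open>-e\<close>, which
        leaves \<open>2 *\<^sub>R u + z\<close>.\<close>
      also have "\<dots> \<le> C * (norm (e + z - 1 *\<^sub>R axis j 1) + norm (a' + z - (-1) *\<^sub>R axis j 1))"
        using C by (intro recovers_imp_dist_le[OF k _ eq rec]) auto
      also have "\<dots> = C * (norm z + norm (2 *\<^sub>R u + z))" by (simp add: a'_def e_def)
      also have "\<dots> \<le> C * (18 / (10 * C))"
      proof (rule mult_left_mono)
        \<comment> \<open>Both copies of \<open>z\<close> and the vector
          \<open>2 *\<^sub>R u\<close> have norm at most \<open>6 / (10 * C)\<close>.\<close>
        show "norm z + norm (2 *\<^sub>R u + z) \<le> 18 / (10 * C)"
          using norm_triangle_ineq[of "2 *\<^sub>R u" z] nz nu by simp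
      qed (use C in simp)
      also have "\<dots> = 18 / 10" using C by simp
      finally have "norm (e - u) \<le> 9 / 10" by simp
      then have "(norm (e - u))\<^sup>2 \<le> (9 / 10)\<^sup>2" by (rule power_mono) simp
      with neu u9 show False by (simp add: power2_eq_square)
    qed
  qed (use eu na' in auto)
qed

section \<open>Volume of the failure set of one fixed pair\<close>

lemma emeasure_lborel_translation_vimage:
  fixes a :: "'a::euclidean_space"
  assumes [measurable]: "S \<in> sets borel"
  shows "emeasure lborel ((+) a -` S) = emeasure lborel S"
proof -
  have "emeasure lborel S = emeasure (distr lborel borel ((+) a)) S"
    by (simp add: lborel_distr_plus)
  also have "\<dots> = emeasure lborel ((+) a -` S)"
    by (subst emeasure_distr) auto
  finally show ?thesis ..
qed

lemma cylinder_translation: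
  assumes "vec_restrict T a = a" "z \<in> cylinder T r b"
  shows "a + z \<in> cylinder T (norm a + r) b"
proof -
  interpret bounded_linear "vec_restrict T" by (rule bounded_linear_vec_restrict)
  show ?thesis
    using assms norm_triangle_ineq[of a "vec_restrict T z"] by (simp add: cylinder_def add)
qed

text \<open>Each \<open>z\<close> in the small cylinder has a translate by \<open>a\<close> or
  \<open>a'\<close> in the failure set, so two translated copies of that set cover the cylinder. As
  \<open>a\<close> and \<open>a'\<close> are unit vectors, enlarging the radius by 1 keeps the
  translates inside.\<close>

lemma failure_volume:
  fixes \<Phi> :: "nat \<Rightarrow> real ^ 'n" and T :: "'n set"
  assumes "C \<ge> 1" "1 \<le> k" "k \<le> CARD('n)" "T \<noteq> {}"
    and "real m / real (card T) \<le> 9 / (100 * C\<^sup>2)"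
    and F: "{x. \<not> recovers m k C \<Phi> A x} \<in> sets borel"
  shows "emeasure lborel (cylinder T (1 / (2 * C)) (1 / (10 * C))) \<le>
    2 * emeasure lborel (cylinder T (1 + 1 / (2 * C)) (1 / (10 * C)) \<inter> {x. \<not> recovers m k C \<Phi> A x})"
    (is "emeasure lborel ?Z \<le> 2 * emeasure lborel ?S'")
proof -
  define S where "S = ?S'"
  obtain a a' where a: "vec_restrict T a = a" "norm a = 1" "vec_restrict T a' = a'" "norm a' = 1"
    "\<And>z. z \<in> ?Z \<Longrightarrow> \<not> recovers m k C \<Phi> A (a + z) \<or> \<not> recovers m k C \<Phi> A (a' + z)"
    using ambiguous_pair[OF assms(1-5)] by metis
  have S [measurable]: "S \<in> sets borel" unfolding S_def using F by (intro sets.Int cylinder_borel)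
  have "?Z \<subseteq> (+) a -` S \<union> (+) a' -` S"
    unfolding S_def using a cylinder_translation[OF a(1)] cylinder_translation[OF a(3)] by fastforce
  moreover have [measurable]: "(+) b -` S \<in> sets borel" for b
    using measurable_sets[of "(+) b" borel borel S] by simp
  ultimately have "emeasure lborel ?Z \<le> emeasure lborel ((+) a -` S \<union> (+) a' -` S)"
    by (intro emeasure_mono) auto
  also have "\<dots> \<le> emeasure lborel ((+) a -` S) + emeasure lborel ((+) a' -` S)"
    by (intro emeasure_subadditive) auto
  also have "\<dots> = 2 * emeasure lborel S"
    by (simp only: emeasure_lborel_translation_vimage[OF S] mult_2)
  finally show ?thesis unfolding S_def .
qed

section \<open>Averaging over the scheme\<close>

lemma foreach_scheme_failure_section:
  assumes "foreach_scheme m k C p M" "(\<Phi>, A) \<in> space M"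
  shows "{x. \<not> recovers m k C \<Phi> A x} \<in> sets borel"
proof -
  have [measurable]: "Measurable.pred (M \<Otimes>\<^sub>M borel) (\<lambda>((\<Phi>, A), x). recovers m k C \<Phi> A x)"
    using assms(1) by (simp add: foreach_scheme_def)
  have "Measurable.pred borel (\<lambda>x. (\<lambda>((\<Phi>, A), x). recovers m k C \<Phi> A x) ((\<Phi>, A), x))"
    by (rule measurable_compose[OF measurable_Pair1'[OF assms(2)]]) measurable
  then have [measurable]: "Measurable.pred borel (recovers m k C \<Phi> A)" by simp
  show ?thesis by measurable
qed

text \<open>Fubini for the joint failure event: a fixed pair fails on volume at least
  \<open>v\<close> of \<open>B\<close>, while a fixed \<open>x\<close> is failed with probability at
  most \<open>p\<close>.\<close>

lemma foreach_scheme_average_failure: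
  fixes M :: "((nat \<Rightarrow> real ^ 'n) \<times> ((nat \<Rightarrow> real) \<Rightarrow> real ^ 'n)) measure"
  assumes M: "foreach_scheme m k C p M" and B [measurable]: "B \<in> sets borel"
    and v: "\<And>\<Phi> A. (\<Phi>, A) \<in> space M \<Longrightarrow> v \<le> emeasure lborel (B \<inter> {x. \<not> recovers m k C \<Phi> A x})"
  shows "v \<le> ennreal p * emeasure lborel B"
proof -
  interpret prob_space M using M by (simp add: foreach_scheme_def)
  interpret pair_sigma_finite M "lborel :: (real ^ 'n) measure" ..
  define R where "R = (\<lambda>((\<Phi>, A), x :: real ^ 'n). recovers m k C \<Phi> A x)"
  \<comment> \<open>Schemes are measurable with respect to \<open>borel\<close>; Fubini needs the
    measure \<open>lborel\<close>, which has the same measurable sets.\<close>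
  have [measurable]: "Measurable.pred (M \<Otimes>\<^sub>M lborel) R"
  proof -
    have "sets (M \<Otimes>\<^sub>M lborel) = sets (M \<Otimes>\<^sub>M (borel :: (real ^ 'n) measure))"
      by (intro sets_pair_measure_cong) auto
    then have "(M \<Otimes>\<^sub>M lborel) \<rightarrow>\<^sub>M count_space UNIV =
        (M \<Otimes>\<^sub>M (borel :: (real ^ 'n) measure)) \<rightarrow>\<^sub>M (count_space UNIV :: bool measure)"
      by (rule measurable_cong_sets) simp
    then show ?thesis using M by (simp add: foreach_scheme_def R_def)
  qed
  define E where "E = {w \<in> space (M \<Otimes>\<^sub>M lborel). \<not> R w \<and> snd w \<in> B}"
  have E [measurable]: "E \<in> sets (M \<Otimes>\<^sub>M lborel)" unfolding E_def by measurable
  have "v = (\<integral>\<^sup>+\<omega>. v \<partial>M)" by (simp add: emeasure_space_1)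
  also have "\<dots> \<le> (\<integral>\<^sup>+\<omega>. emeasure lborel (Pair \<omega> -` E) \<partial>M)"
  proof (rule nn_integral_mono)
    fix \<omega> assume \<omega>: "\<omega> \<in> space M"
    obtain \<Phi> A where w: "\<omega> = (\<Phi>, A)" by (cases \<omega>)
    have "Pair \<omega> -` E = B \<inter> {x. \<not> recovers m k C \<Phi> A x}"
      using \<omega> by (auto simp: E_def w R_def space_pair_measure)
    with v[of \<Phi> A] \<omega> w show "v \<le> emeasure lborel (Pair \<omega> -` E)" by simp
  qed
  also have "\<dots> = emeasure (M \<Otimes>\<^sub>M lborel) E"
    by (rule lborel.emeasure_pair_measure_alt[OF E, symmetric])
  also have "\<dots> = (\<integral>\<^sup>+x. emeasure M ((\<lambda>\<omega>. (\<omega>, x)) -` E) \<partial>lborel)"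
    by (rule emeasure_pair_measure_alt2[OF E])
  also have "\<dots> \<le> (\<integral>\<^sup>+x. ennreal p * indicator B x \<partial>lborel)"
  proof (rule nn_integral_mono)
    fix x :: "real ^ 'n"
    show "emeasure M ((\<lambda>\<omega>. (\<omega>, x)) -` E) \<le> ennreal p * indicator B x"
    proof (cases "x \<in> B")
      case True
      define G where "G = {(\<Phi>, A) \<in> space M. recovers m k C \<Phi> A x}"
      have G: "G = {\<omega> \<in> space M. R (\<omega>, x)}" by (auto simp: G_def R_def)
      have [measurable]: "G \<in> sets M" unfolding G by measurable
      have "(\<lambda>\<omega>. (\<omega>, x)) -` E = space M - G"
        using True by (auto simp: E_def G space_pair_measure)
      then have "emeasure M ((\<lambda>\<omega>. (\<omega>, x)) -` E) = ennreal (1 - prob G)"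
        by (simp add: emeasure_eq_measure prob_compl)
      also have "\<dots> \<le> ennreal p"
        using M by (intro ennreal_leI) (simp add: foreach_scheme_def G_def algebra_simps)
      finally show ?thesis using True by simp
    next
      case False
      then have "(\<lambda>\<omega>. (\<omega>, x)) -` E = {}" by (auto simp: E_def)
      then show ?thesis by simp
    qed
  qed
  also have "\<dots> = ennreal p * emeasure lborel B"
    by (simp add: nn_integral_cmult)
  finally show ?thesis .
qed

text \<open>The two cylinder radii have ratio \<open>2 * C + 1\<close>, so the volumes have ratio
  \<open>(2 * C + 1) ^ n\<close>. Averaging compares half the small volume with \<open>p\<close>
  times the large one, and the small volume cancels.\<close>

lemma foreach_scheme_failure_probability_ge:
  fixes M :: "((nat \<Rightarrow> real ^ 'n) \<times> ((nat \<Rightarrow> real) \<Rightarrow> real ^ 'n)) measure"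
  assumes C: "C \<ge> 1" and k: "1 \<le> k" "k \<le> CARD('n)" and p: "0 \<le> p"
    and M: "foreach_scheme m k C p M"
    and n: "0 < n" "n \<le> CARD('n)" and m: "real m / real n \<le> 9 / (100 * C\<^sup>2)"
  shows "1 \<le> 2 * p * (2 * C + 1) ^ n"
proof -
  obtain T :: "'n set" where T: "card T = n"
    using obtain_subset_with_card_n[OF n(2)] by auto
  have "T \<noteq> {}" using T n by auto
  let ?d = "1 / (2 * C)" and ?t = "1 / (10 * C)"
  let ?V = "emeasure lborel (cylinder T ?d ?t)"
  have "(2 * C + 1) * ?d = 1 + ?d" using C by (simp add: field_simps)
  then have B: "emeasure lborel (cylinder T (1 + ?d) ?t) = ennreal ((2 * C + 1) ^ n) * ?V"
    using emeasure_cylinder_scale[of "2 * C + 1" T ?d ?t] C T by simp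
  have "?V / 2 \<le> ennreal p * emeasure lborel (cylinder T (1 + ?d) ?t)"
  proof (rule foreach_scheme_average_failure[OF M cylinder_borel])
    fix \<Phi> A assume "(\<Phi>, A) \<in> space M"
    from failure_volume[OF C k \<open>T \<noteq> {}\<close> _ foreach_scheme_failure_section[OF M this]] m T
    show "?V / 2 \<le> emeasure lborel
        (cylinder T (1 + ?d) ?t \<inter> {x. \<not> recovers m k C \<Phi> A x})"
      by (intro divide_le_posI_ennreal) (auto simp: mult.commute)
  qed
  then have le: "?V / 2 \<le> ennreal p * (ennreal ((2 * C + 1) ^ n) * ?V)" by (simp only: B)
  obtain v where v: "?V = ennreal v" "0 \<le> v"
    using emeasure_cylinder_finite[of T ?d ?t] by (cases ?V) auto
  have "0 < v"
    using emeasure_cylinder_pos[of ?d ?t T] C v by simp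
  have "ennreal (v / 2) \<le> ennreal (p * ((2 * C + 1) ^ n * v))"
    using le p C v by (simp add: ennreal_mult' divide_ennreal flip: ennreal_numeral)
  then have "v / 2 \<le> p * ((2 * C + 1) ^ n * v)"
    using p C v by (subst (asm) ennreal_le_iff) auto
  then show ?thesis using \<open>0 < v\<close> by (simp add: field_simps)
qed

section \<open>Excluding zero measurements\<close>

text \<open>Without measurements the decoder has one output, but multiples of \<open>e\<close> are
  1-sparse and must be recovered exactly. Their success events are disjoint, each of probability at
  least \<open>1 - p\<close>, so enough of them exceed total mass 1.\<close>

lemma foreach_scheme_measurements_pos:
  fixes M :: "((nat \<Rightarrow> real ^ 'n) \<times> ((nat \<Rightarrow> real) \<Rightarrow> real ^ 'n)) measure"
  assumes C: "C \<ge> 0" and k: "1 \<le> k" "k \<le> CARD('n)" and p: "p < 1"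
    and M: "foreach_scheme m k C p M"
  shows "0 < m"
proof (rule ccontr)
  assume "\<not> 0 < m"
  then have m: "m = 0" by simp
  interpret prob_space M using M by (simp add: foreach_scheme_def)
  define e where "e = (axis undefined 1 :: real ^ 'n)"
  define E where "E i = {(\<Phi>, A) \<in> space M. recovers m k C \<Phi> A (real i *\<^sub>R e)}" for i
  have ge: "1 - p \<le> prob (E i)" for i
    using M by (simp add: foreach_scheme_def E_def)
  \<comment> \<open>Non-measurable sets have measure 0 by default, so positive measure implies
    measurability.\<close>
  have sets: "E i \<in> sets M" for i
    using ge[of i] p measure_notin_sets[of "E i" M] by fastforce
  have disj: "disjoint_family E"
  proof (unfold disjoint_family_on_def, safe)
    fix i l \<Phi> A
    assume "(\<Phi>, A) \<in> E i" "(\<Phi>, A) \<in> E l" "i \<noteq> l"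
    then have "norm (real i *\<^sub>R e - real l *\<^sub>R e) \<le>
        C * (norm (real i *\<^sub>R e - real i *\<^sub>R axis undefined 1)
          + norm (real l *\<^sub>R e - real l *\<^sub>R axis undefined 1))"
      by (intro recovers_imp_dist_le[OF k C measurements_eqI]) (auto simp: E_def m)
    then have "i = l" by (simp add: e_def)
    with \<open>i \<noteq> l\<close> show "(\<Phi>, A) \<in> {}" by simp
  qed
  obtain n :: nat where n: "1 < real n * (1 - p)"
    using reals_Archimedean3[of "1 - p"] p by auto
  have "real n * (1 - p) = (\<Sum>i<n. 1 - p)" by simp
  also have "\<dots> \<le> (\<Sum>i<n. prob (E i))" by (intro sum_mono ge)
  also have "\<dots> = prob (\<Union>i<n. E i)"
    using sets disj by (intro finite_measure_finite_Union[symmetric])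
      (auto intro: disjoint_family_on_mono)
  also have "\<dots> \<le> 1" by (rule prob_le_1)
  finally show False using n by simp
qed

section \<open>Choice of dimension and final estimates\<close>

text \<open>This gives the final contradiction, where \<open>n\<close> is the floor of a number
  above 28.\<close>

lemma linear_less_three_halves_power: "n \<ge> 27 \<Longrightarrow> 4 * real n + 4 < (3 / 2) ^ n"
  by (induction n rule: dec_induct) (simp_all add: power_divide)

theorem theorem3p4:
  fixes M :: "((nat \<Rightarrow> real ^ 'n) \<times> ((nat \<Rightarrow> real) \<Rightarrow> real ^ 'n)) measure"
    and C p :: real and m k :: nat
  assumes "C \<ge> 1"
    and "1 \<le> k" and "k \<le> CARD('n)"
    and "sqrt (12 + 16 * C\<^sup>2) * exp (- (ln (6 + 8 * C\<^sup>2) / 2) * real CARD('n)) \<le> p"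
    and "p < 1"
    and "foreach_scheme m k C p M"
  shows "real m \<ge> 1 / ((6 + 8 * C\<^sup>2) * ln (6 + 8 * C\<^sup>2)) * ln (sqrt (12 + 16 * C\<^sup>2) / p)
    \<and> (\<lambda>q. 1 / ((6 + 8 * C\<^sup>2) * ln (6 + 8 * C\<^sup>2)) * ln (sqrt (12 + 16 * C\<^sup>2) / q))
        \<in> \<Omega>[at_right 0](\<lambda>q::real. ln (1 / q))"
proof
  define D where "D = 6 + 8 * C\<^sup>2"
  define s where "s = sqrt (12 + 16 * C\<^sup>2)"
  have D14: "D \<ge> 14" using \<open>C \<ge> 1\<close> by (simp add: D_def)
  then have lnD: "ln D > 0" by simp
  have s2: "s\<^sup>2 = 2 * D" by (simp add: s_def D_def)
  have s: "s \<ge> 1" by (simp add: s_def)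
  have p4: "s * exp (- (ln D / 2) * real CARD('n)) \<le> p"
    using assms(4) by (simp only: s_def D_def)
  have p0: "p > 0"
    by (rule less_le_trans[OF _ p4]) (use s in simp)
  \<comment> \<open>\<open>X\<close> solves \<open>D powr X = (s / p)\<^sup>2\<close>; the bound to
    be shown is equivalent to \<open>X \<le> 2 * D * real m\<close>.\<close>
  define X where "X = 2 * ln (s / p) / ln D"
  have XlnD: "X * ln D = 2 * ln (s / p)" using lnD by (simp add: X_def)
  have "exp (X * ln D) = (s / p)\<^sup>2"
    unfolding XlnD using s p0 by (simp add: exp_double)
  then have expX: "p\<^sup>2 * exp (X * ln D) = 2 * D"
    using p0 by (simp add: power_divide s2)
  \<comment> \<open>The lower bound on \<open>p\<close> ensures that there are enough coordinates
    for a set \<open>T\<close> of size \<open>n\<close>.\<close>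
  have XN: "X \<le> real CARD('n)"
  proof -
    have "ln (s * exp (- (ln D / 2) * real CARD('n))) \<le> ln p"
      using p4 s p0 by (subst ln_le_cancel_iff) auto
    then have "ln s - ln D / 2 * real CARD('n) \<le> ln p"
      using s by (simp add: ln_mult)
    then have "X * ln D \<le> real CARD('n) * ln D"
      unfolding XlnD using s p0 by (simp add: ln_div algebra_simps)
    then show ?thesis using lnD by simp
  qed
  have m1: "real m \<ge> 1"
    using foreach_scheme_measurements_pos[OF _ assms(2,3,5,6)] assms(1) by simp
  have "X \<le> 2 * D * real m"
  proof (rule ccontr)
    assume "\<not> ?thesis"
    then have X: "2 * D * real m < X" by simp
    define n where "n = nat \<lfloor>X\<rfloor>"
    have "2 * D * 1 \<le> 2 * D * real m" using m1 D14 by (intro mult_left_mono) auto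
    then have XD: "2 * D < X" using X by linarith
    then have nX: "real n \<le> X" "X < real n + 1" using D14 by (auto simp: n_def)
    have "n \<ge> 27" using nX XD D14 by linarith
    \<comment> \<open>Since \<open>2 * D - 1 = 11 + 16 * C\<^sup>2\<close> and \<open>m\<close> is
      at least 1, the loss from rounding \<open>X\<close> down is absorbed. The requirement on
      \<open>m / n\<close> then follows from \<open>100 / 16 \<le> 9\<close>.\<close>
    have "(16 * C\<^sup>2) * real m \<le> (2 * D - 1) * real m"
      unfolding D_def by (intro mult_right_mono) auto
    also have "\<dots> \<le> real n" using X nX m1 by (simp add: left_diff_distrib)
    finally have "100 / 16 * (16 * C\<^sup>2 * real m) \<le> 100 / 16 * real n" by linarith
    also have "\<dots> \<le> 9 * real n" by simp
    finally have "real m * (100 * C\<^sup>2) \<le> 9 * real n" by (simp add: mult_ac)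
    then have "real m / real n \<le> 9 / (100 * C\<^sup>2)"
      using \<open>n \<ge> 27\<close> \<open>C \<ge> 1\<close> by (simp add: divide_simps)
    then have "1 \<le> 2 * p * (2 * C + 1) ^ n"
      using \<open>n \<ge> 27\<close> nX XN p0
      by (intro foreach_scheme_failure_probability_ge[OF assms(1-3) _ assms(6)]) auto
    then have "1\<^sup>2 \<le> (2 * p * (2 * C + 1) ^ n)\<^sup>2" by (rule power_mono) simp
    then have one: "1 \<le> 4 * p\<^sup>2 * ((2 * C + 1)\<^sup>2) ^ n"
      by (simp add: power_mult_distrib power_even_eq flip: power_mult)
    \<comment> \<open>The difference of the two sides is
      \<open>(2 * C - 3)\<^sup>2 / 2\<close>.\<close>
    have "3 / 2 * (2 * C + 1)\<^sup>2 \<le> D"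
      using zero_le_power2[of "2 * C - 3"] by (simp add: D_def power2_eq_square algebra_simps)
    then have "(3 / 2 * (2 * C + 1)\<^sup>2) ^ n \<le> D ^ n" by (rule power_mono) simp
    also have "D ^ n = exp (real n * ln D)" using D14 by (simp add: exp_of_nat_mult)
    also have "\<dots> \<le> exp (X * ln D)" using nX lnD by simp
    finally have *: "(3 / 2) ^ n * ((2 * C + 1)\<^sup>2) ^ n \<le> exp (X * ln D)"
      by (simp only: power_mult_distrib)
    \<comment> \<open>The spare factor 3/2 makes the left side exponential in \<open>n\<close>,
      while the right side collapses to \<open>8 * D\<close>, which is below
      \<open>4 * n + 4\<close>.\<close>
    have "(3 / 2) ^ n * 1 \<le> (3 / 2) ^ n * (4 * p\<^sup>2 * ((2 * C + 1)\<^sup>2) ^ n)"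
      using one by (intro mult_left_mono) auto
    also have "\<dots> = 4 * p\<^sup>2 * ((3 / 2) ^ n * ((2 * C + 1)\<^sup>2) ^ n)" by simp
    also have "\<dots> \<le> 4 * p\<^sup>2 * exp (X * ln D)"
      using * by (intro mult_left_mono) auto
    also have "\<dots> = 8 * D" using expX by simp
    also have "\<dots> \<le> 4 * real n + 4" using XD nX by linarith
    finally show False using linear_less_three_halves_power[OF \<open>n \<ge> 27\<close>] by simp
  qed
  then have "1 / (D * ln D) * ln (s / p) \<le> real m"
    using lnD D14 by (simp add: X_def field_simps)
  then show "real m \<ge> 1 / ((6 + 8 * C\<^sup>2) * ln (6 + 8 * C\<^sup>2)) * ln (sqrt (12 + 16 * C\<^sup>2) / p)"
    by (simp only: D_def s_def)
  \<comment> \<open>The prefactor itself serves as the constant: for \<open>q\<close> in (0,1),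
    \<open>s \<ge> 1\<close> gives \<open>ln (s / q) \<ge> ln (1 / q) \<ge> 0\<close>.\<close>
  have "(\<lambda>q. 1 / (D * ln D) * ln (s / q)) \<in> \<Omega>[at_right 0](\<lambda>q::real. ln (1 / q))"
  proof (rule landau_omega.bigI)
    show "1 / (D * ln D) > 0" using lnD D14 by simp
    have "\<forall>\<^sub>F q in at_right (0::real). q \<in> {0<..<1}"
      by (rule eventually_at_right_real) simp
    then show "\<forall>\<^sub>F q in at_right 0.
        norm (1 / (D * ln D) * ln (s / q)) \<ge> 1 / (D * ln D) * norm (ln (1 / q))"
    proof eventually_elim
      case (elim q)
      have "\<bar>ln (1 / q)\<bar> \<le> \<bar>ln (s / q)\<bar>" using elim s by (simp add: ln_div)
      then show ?case using lnD D14 by (simp add: abs_mult divide_right_mono)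
    qed
  qed
  then show "(\<lambda>q. 1 / ((6 + 8 * C\<^sup>2) * ln (6 + 8 * C\<^sup>2)) * ln (sqrt (12 + 16 * C\<^sup>2) / q))
      \<in> \<Omega>[at_right 0](\<lambda>q::real. ln (1 / q))"
    by (simp only: D_def s_def)
qed

end
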